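(* Let $T:\mathscr{H}\to\mathscr{K}$ be a nonzero bounded linear map and let $c\in(-1,1)$. Then there exists $\varepsilon\in[0,1+|c|)$ such that $T$ is an $(\varepsilon,c)$-angle preserving mapping if and only if $T$ is bounded below.
   Context: $\mathscr{H},\mathscr{K}$ are real Hilbert spaces, each of dimension at least $2$ (possibly infinite). For $c\in(-1,1)$, $\varepsilon\ge 0$ and vectors $x,y$: $x\,\angle_c\,y$ means $\langle x,y\rangle=c\,\|x\|\,\|y\|$, and $x\,\angle_c^{\varepsilon}\,y$ means $\big|\langle x,y\rangle-c\|x\|\|y\|\big|\le\varepsilon\|x\|\|y\|$. A map $T:\mathscr{H}\to\mathscr{K}$ is $(\varepsilon,c)$-angle preserving if $x\,\angle_c\,y\Rightarrow Tx\,\angle_c^{\varepsilon}\,Ty$ for all $x,y\in\mathscr{H}$. $T$ is bounded below if there is $m>0$ with $\|Tx\|\ge m\|x\|$ for all $x\in\mathscr{H}$. *)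

theory Defs
  imports "HOL-Analysis.Analysis"
begin

text \<open>A real Hilbert space is a type of sort \<open>{real_inner, complete_space}\<close>.
  The library's \<open>dim\<close> is not informative for infinite-dimensional spaces, so the lower bound
  on the dimension is expressed through linearly independent sets.\<close>

definition dim_at_least :: "nat \<Rightarrow> 'a::real_vector itself \<Rightarrow> bool" where
  "dim_at_least n _ \<longleftrightarrow> (\<exists>B :: 'a set. independent B \<and> finite B \<and> card B = n)"

definition angle_c :: "real \<Rightarrow> 'a::real_inner \<Rightarrow> 'a \<Rightarrow> bool" where
  "angle_c c x y \<longleftrightarrow> x \<bullet> y = c * norm x * norm y"

definition approx_angle_c :: "real \<Rightarrow> real \<Rightarrow> 'a::real_inner \<Rightarrow> 'a \<Rightarrow> bool" where
  "approx_angle_c \<epsilon> c x y \<longleftrightarrow> \<bar>x \<bullet> y - c * norm x * norm y\<bar> \<le> \<epsilon> * norm x * norm y"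

definition angle_preserving ::
    "real \<Rightarrow> real \<Rightarrow> ('a::real_inner \<Rightarrow> 'b::real_inner) \<Rightarrow> bool" where
  "angle_preserving \<epsilon> c T \<longleftrightarrow> (\<forall>x y. angle_c c x y \<longrightarrow> approx_angle_c \<epsilon> c (T x) (T y))"

definition bounded_below :: "('a::real_normed_vector \<Rightarrow> 'b::real_normed_vector) \<Rightarrow> bool" where
  "bounded_below T \<longleftrightarrow> (\<exists>m>0. \<forall>x. norm (T x) \<ge> m * norm x)"

end

theory Submission
  imports Defs
begin

text \<open>
  Write \<open>\<theta>\<close> for the angle between \<open>T x\<close> and \<open>T y\<close>.  Whenever \<open>T x\<close> and \<open>T y\<close> are nonzero,
  \<open>T x \<angle>\<^sub>c\<^sup>\<epsilon> T y\<close> says \<open>\<bar>cos \<theta> - c\<bar> \<le> \<epsilon>\<close>.  The left-hand side can reach the value \<open>1 + \<bar>c\<bar>\<close> only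
  if \<open>T\<close> sends two vectors at angle \<open>arccos c\<close> to parallel ones that point in opposite
  directions (\<open>c > 0\<close>), in the same direction (\<open>c < 0\<close>) or in either (\<open>c = 0\<close>).  A bound
  \<open>\<epsilon> < 1 + \<bar>c\<bar>\<close> says that \<open>T\<close> stays uniformly away from such a collapse.

  If \<open>T\<close> is bounded below, no collapse occurs: after rescaling \<open>x\<close> and \<open>y\<close> so that their
  images are unit vectors, \<open>T x \<plusminus> T y\<close> is not small because \<open>x \<plusminus> y\<close> is not small, and this
  bounds \<open>\<bar>cos \<theta>\<bar>\<close> away from \<open>1\<close> (lemma \<open>bounded_below_imp_inner_bound\<close>).

  For the converse the sign of \<open>c\<close> is immaterial, since \<open>y\<close> may be replaced by \<open>-y\<close>
  (lemma \<open>angle_preserving_abs\<close>).  Let \<open>z\<close>, \<open>w\<close> be orthonormal with \<open>T z\<close> much shorter than \<open>T w\<close>.  The two vectors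
  \<open>p z \<plusminus> q w\<close>, with \<open>p\<close>, \<open>q\<close> chosen to put them at angle \<open>arccos \<bar>c\<bar>\<close>, have images close to
  \<open>\<plusminus>q T w\<close>, which are antiparallel.  Hence \<open>\<epsilon> < 1 + \<bar>c\<bar>\<close> forces the stretching factors of \<open>T\<close>
  in any two orthogonal directions to be comparable (lemmas \<open>angle_preserving_orthogonal_sq\<close>
  and \<open>angle_preserving_orthogonal\<close>).  A single direction in which \<open>T\<close> does not vanish then
  bounds the stretching in every direction from below (lemma
  \<open>bounded_below_if_orthogonal_comparable\<close>).
\<close>

section \<open>Bounded below maps keep angles away from degeneracy\<close>

text \<open>
  The law of cosines turns the right-hand side into \<open>a\<^sup>2 + b\<^sup>2 + 2 c a b\<close>, a quadratic form in
  the lengths \<open>a\<close>, \<open>b\<close> whose eigenvalues are \<open>1 \<plusminus> c\<close>.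
\<close>

lemma angle_c_norm_add_ge:
  fixes x y :: "'a::real_inner"
  assumes "angle_c c x y" and "\<bar>c\<bar> \<le> 1"
  shows "(1 - \<bar>c\<bar>) * ((norm x)\<^sup>2 + (norm y)\<^sup>2) \<le> (norm (x + y))\<^sup>2"
proof -
  have "2 * (norm x * norm y) \<le> (norm x)\<^sup>2 + (norm y)\<^sup>2"
    using sum_squares_bound[of "norm x" "norm y"] by (simp add: mult.assoc)
  then have "\<bar>c\<bar> * (2 * (norm x * norm y)) \<le> \<bar>c\<bar> * ((norm x)\<^sup>2 + (norm y)\<^sup>2)"
    by (intro mult_left_mono) auto
  moreover have "- (\<bar>c\<bar> * (norm x * norm y)) \<le> c * (norm x * norm y)"
    using mult_right_mono[of "- \<bar>c\<bar>" c "norm x * norm y"] by simp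
  moreover have "(norm (x + y))\<^sup>2 = (norm x)\<^sup>2 + (norm y)\<^sup>2 + 2 * (c * (norm x * norm y))"
    using assms(1) by (simp add: angle_c_def power2_norm_eq_inner inner_add_left inner_add_right
        inner_commute mult.assoc)
  ultimately show ?thesis
    by (simp add: algebra_simps)
qed

lemma angle_c_scaleR:
  assumes "angle_c c x y" and "0 \<le> a" and "0 \<le> b"
  shows "angle_c c (a *\<^sub>R x) (b *\<^sub>R y)"
  using assms by (simp add: angle_c_def)

lemma angle_c_minus_right: "angle_c (- c) x (- y) \<longleftrightarrow> angle_c c x y"
  by (auto simp: angle_c_def)

text \<open>
  For images of length one, \<open>\<parallel>T x + T y\<parallel>\<^sup>2 = 2 + 2 (T x \<bullet> T y)\<close>, so a lower bound on the norm
  of \<open>T (x + y)\<close> keeps the inner product away from \<open>-1\<close>.  Applied to \<open>-y\<close> and \<open>-c\<close>, the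
  lemma also keeps it away from \<open>1\<close>.
\<close>

lemma bounded_below_imp_inner_lower:
  fixes T :: "'a::real_inner \<Rightarrow> 'b::real_inner"
  assumes T: "linear T" and m: "0 < m" "\<And>x. m * norm x \<le> norm (T x)"
    and M: "0 < M" "\<And>x. norm (T x) \<le> M * norm x"
    and ang: "angle_c c x y" and c: "\<bar>c\<bar> \<le> 1"
  shows "- (1 - m\<^sup>2 * (1 - \<bar>c\<bar>) / M\<^sup>2) * (norm (T x) * norm (T y)) \<le> T x \<bullet> T y"
proof (cases "T x = 0 \<or> T y = 0")
  case True
  then show ?thesis by auto
next
  case False
  define a where "a = inverse (norm (T x))"
  define b where "b = inverse (norm (T y))"
  have ab: "0 < a" "0 < b" using False by (auto simp: a_def b_def)
  \<comment> \<open>The rescaled vectors have unit images, hence norm at least \<open>1 / M\<close>.\<close>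
  have unit: "norm (T (a *\<^sub>R x)) = 1" "norm (T (b *\<^sub>R y)) = 1"
    using False by (auto simp: a_def b_def linear_scale[OF T])
  have large: "1 / M\<^sup>2 \<le> (norm u)\<^sup>2" if "norm (T u) = 1" for u
  proof -
    have "1 / M \<le> norm u" using M(2)[of u] M(1) that by (simp add: field_simps)
    then have "(1 / M)\<^sup>2 \<le> (norm u)\<^sup>2" using M(1) by (intro power_mono) auto
    then show ?thesis by (simp add: power_one_over)
  qed
  have "m\<^sup>2 * ((1 - \<bar>c\<bar>) * (2 / M\<^sup>2))
      \<le> m\<^sup>2 * ((1 - \<bar>c\<bar>) * ((norm (a *\<^sub>R x))\<^sup>2 + (norm (b *\<^sub>R y))\<^sup>2))"
    using large[OF unit(1)] large[OF unit(2)] c by (intro mult_left_mono) auto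
  also have "\<dots> \<le> m\<^sup>2 * (norm (a *\<^sub>R x + b *\<^sub>R y))\<^sup>2"
    using angle_c_norm_add_ge[OF angle_c_scaleR[OF ang] c] ab by (intro mult_left_mono) auto
  also have "\<dots> \<le> (norm (T (a *\<^sub>R x + b *\<^sub>R y)))\<^sup>2"
    using power_mono[OF m(2)[of "a *\<^sub>R x + b *\<^sub>R y"], of 2] m(1) by (simp add: power_mult_distrib)
  also have "\<dots> = 2 + 2 * (T (a *\<^sub>R x) \<bullet> T (b *\<^sub>R y))"
    using unit by (simp add: linear_add[OF T] norm_eq_1 power2_norm_eq_inner inner_add_left
        inner_add_right inner_commute)
  finally have "2 * (m\<^sup>2 * (1 - \<bar>c\<bar>) / M\<^sup>2) \<le> 2 + 2 * (T (a *\<^sub>R x) \<bullet> T (b *\<^sub>R y))"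
    by (simp add: algebra_simps)
  then have "- (1 - m\<^sup>2 * (1 - \<bar>c\<bar>) / M\<^sup>2) \<le> T (a *\<^sub>R x) \<bullet> T (b *\<^sub>R y)"
    by linarith
  also have "\<dots> = (T x \<bullet> T y) / (norm (T x) * norm (T y))"
    by (simp add: linear_scale[OF T] a_def b_def field_simps)
  finally show ?thesis
    using False by (simp add: pos_le_divide_eq)
qed

lemma bounded_below_imp_inner_bound:
  fixes T :: "'a::real_inner \<Rightarrow> 'b::real_inner"
  assumes T: "linear T" and m: "0 < m" "\<And>x. m * norm x \<le> norm (T x)"
    and M: "0 < M" "\<And>x. norm (T x) \<le> M * norm x"
    and ang: "angle_c c x y" and c: "\<bar>c\<bar> \<le> 1"
  shows "\<bar>T x \<bullet> T y\<bar> \<le> (1 - m\<^sup>2 * (1 - \<bar>c\<bar>) / M\<^sup>2) * (norm (T x) * norm (T y))"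
proof -
  have "angle_c (- c) x (- y)" using ang by (simp add: angle_c_minus_right)
  then show ?thesis
    using bounded_below_imp_inner_lower[OF T m M ang c]
      bounded_below_imp_inner_lower[OF T m M, of "- c" x "- y"] c
    by (simp add: linear_neg[OF T] abs_le_iff left_diff_distrib)
qed

lemma bounded_below_imp_angle_preserving:
  fixes T :: "'a::real_inner \<Rightarrow> 'b::real_inner"
  assumes T: "bounded_linear T" and nz: "T w \<noteq> 0" and c: "\<bar>c\<bar> < 1" and bb: "bounded_below T"
  shows "\<exists>\<epsilon>\<in>{0..<1 + \<bar>c\<bar>}. angle_preserving \<epsilon> c T"
proof -
  interpret bounded_linear T by (rule T)
  obtain m where m: "0 < m" "\<And>x. m * norm x \<le> norm (T x)"
    using bb by (auto simp: bounded_below_def)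
  obtain M where M: "0 < M" "\<And>x. norm (T x) \<le> M * norm x"
    using pos_bounded by (auto simp: mult.commute)
  have "w \<noteq> 0" using nz zero by auto
  then have "m \<le> M" using order_trans[OF m(2)[of w] M(2)[of w]] by simp
  define \<delta> where "\<delta> = m\<^sup>2 * (1 - \<bar>c\<bar>) / M\<^sup>2"
  have "0 < \<delta>" using m(1) M(1) c by (simp add: \<delta>_def)
  have "m\<^sup>2 * (1 - \<bar>c\<bar>) \<le> M\<^sup>2 * 1"
    using \<open>m \<le> M\<close> m(1) c by (intro mult_mono power_mono) auto
  then have "\<delta> \<le> 1" using M(1) by (simp add: \<delta>_def)
  have "angle_preserving (1 + \<bar>c\<bar> - \<delta>) c T"
    unfolding angle_preserving_def
  proof (intro allI impI)
    fix x y :: 'a assume "angle_c c x y"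
    then have "\<bar>T x \<bullet> T y\<bar> \<le> (1 - \<delta>) * (norm (T x) * norm (T y))"
      unfolding \<delta>_def using bounded_below_imp_inner_bound[OF linear_axioms m M] c by simp
    moreover have "\<bar>T x \<bullet> T y - c * (norm (T x) * norm (T y))\<bar>
        \<le> \<bar>T x \<bullet> T y\<bar> + \<bar>c\<bar> * (norm (T x) * norm (T y))"
      using abs_triangle_ineq4[of "T x \<bullet> T y" "c * (norm (T x) * norm (T y))"]
      by (simp add: abs_mult)
    ultimately show "approx_angle_c (1 + \<bar>c\<bar> - \<delta>) c (T x) (T y)"
      by (simp add: approx_angle_c_def algebra_simps)
  qed
  then show ?thesis using \<open>0 < \<delta>\<close> \<open>\<delta> \<le> 1\<close> by (intro bexI[of _ "1 + \<bar>c\<bar> - \<delta>"]) auto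
qed

section \<open>Angle preserving maps stretch orthogonal directions comparably\<close>

text \<open>Replacing \<open>y\<close> by \<open>-y\<close> flips the sign of \<open>c\<close> on both sides of the implication.\<close>

lemma angle_preserving_uminus:
  assumes "linear T" and "angle_preserving \<epsilon> c T"
  shows "angle_preserving \<epsilon> (- c) T"
  unfolding angle_preserving_def
proof (intro allI impI)
  fix x y :: 'a assume "angle_c (- c) x y"
  then have "angle_c c x (- y)" using angle_c_minus_right[of c x "- y"] by simp
  then have "approx_angle_c \<epsilon> c (T x) (- T y)"
    using assms(2) by (auto simp: angle_preserving_def linear_neg[OF assms(1), symmetric])
  then show "approx_angle_c \<epsilon> (- c) (T x) (T y)"
    by (auto simp: approx_angle_c_def)
qed

lemma angle_preserving_abs:
  assumes "linear T" and "angle_preserving \<epsilon> c T"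
  shows "angle_preserving \<epsilon> \<bar>c\<bar> T"
  using assms angle_preserving_uminus[OF assms] by (simp add: abs_if)

text \<open>
  With \<open>p\<^sup>2 + q\<^sup>2 = 1\<close> and \<open>p\<^sup>2 - q\<^sup>2 = c\<close>, the vectors \<open>p z \<plusminus> q w\<close> enclose the angle \<open>arccos c\<close>,
  and their images have inner product \<open>p\<^sup>2 \<parallel>T z\<parallel>\<^sup>2 - q\<^sup>2 \<parallel>T w\<parallel>\<^sup>2\<close>, while by the arithmetic-geometric
  mean inequality and the parallelogram law the product of the norms of the images is at most
  \<open>p\<^sup>2 \<parallel>T z\<parallel>\<^sup>2 + q\<^sup>2 \<parallel>T w\<parallel>\<^sup>2\<close>.  The number \<open>k\<close> is an upper bound for \<open>\<epsilon> - c\<close>, which itself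
  may be negative.
\<close>

lemma angle_preserving_orthogonal_sq:
  fixes T :: "'a::real_inner \<Rightarrow> 'b::real_inner"
  assumes T: "linear T" and ap: "angle_preserving \<epsilon> c T"
    and c: "0 \<le> c" "c < 1" and k: "0 \<le> k" "\<epsilon> - c \<le> k"
    and orth: "z \<bullet> w = 0" and eq: "norm z = norm w"
  shows "(1 - k) * (1 - c) * (norm (T w))\<^sup>2 \<le> (1 + k) * (1 + c) * (norm (T z))\<^sup>2"
proof -
  define p where "p = sqrt ((1 + c) / 2)"
  define q where "q = sqrt ((1 - c) / 2)"
  have pq: "p\<^sup>2 = (1 + c) / 2" "q\<^sup>2 = (1 - c) / 2" using c by (auto simp: p_def q_def)
  define x where "x = p *\<^sub>R z + q *\<^sub>R w"
  define y where "y = p *\<^sub>R z - q *\<^sub>R w"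
  have wz: "w \<bullet> z = 0" using orth by (simp add: inner_commute)
  have sq: "w \<bullet> w = (norm z)\<^sup>2" "z \<bullet> z = (norm z)\<^sup>2"
    using eq by (simp_all add: power2_norm_eq_inner[symmetric])
  have one: "p\<^sup>2 + q\<^sup>2 = 1" and diff: "p\<^sup>2 - q\<^sup>2 = c" using pq by (simp_all add: field_simps)
  have "(norm x)\<^sup>2 = (p\<^sup>2 + q\<^sup>2) * (norm z)\<^sup>2" "(norm y)\<^sup>2 = (p\<^sup>2 + q\<^sup>2) * (norm z)\<^sup>2"
    unfolding power2_norm_eq_inner[of x] power2_norm_eq_inner[of y]
    by (simp_all add: x_def y_def inner_add_left inner_add_right inner_diff_left
        inner_diff_right orth wz sq power2_eq_square[of p] power2_eq_square[of q] algebra_simps)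
  then have "norm x = norm z" "norm y = norm z"
    by (simp_all add: one)
  moreover have "x \<bullet> y = (p\<^sup>2 - q\<^sup>2) * (norm z)\<^sup>2"
    by (simp add: x_def y_def inner_add_left inner_add_right inner_diff_left
        inner_diff_right orth wz sq power2_eq_square[of p] power2_eq_square[of q] algebra_simps)
  ultimately have "angle_c c x y"
    unfolding angle_c_def diff by (simp add: power2_eq_square)
  then have "approx_angle_c \<epsilon> c (T x) (T y)"
    using ap by (simp add: angle_preserving_def)
  then have "- (T x \<bullet> T y) \<le> (\<epsilon> - c) * (norm (T x) * norm (T y))"
    by (simp add: approx_angle_c_def algebra_simps)
  also have "\<dots> \<le> k * (norm (T x) * norm (T y))"
    using k by (intro mult_right_mono) auto
  also have "\<dots> \<le> k * (p\<^sup>2 * (norm (T z))\<^sup>2 + q\<^sup>2 * (norm (T w))\<^sup>2)"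
  proof (intro mult_left_mono k)
    have "(norm (T x))\<^sup>2 + (norm (T y))\<^sup>2 = 2 * (p\<^sup>2 * (norm (T z))\<^sup>2 + q\<^sup>2 * (norm (T w))\<^sup>2)"
      unfolding power2_norm_eq_inner
      by (simp add: x_def y_def linear_add[OF T] linear_diff[OF T] linear_scale[OF T]
          inner_add_left inner_add_right inner_diff_left inner_diff_right power2_eq_square
          algebra_simps)
    then show "norm (T x) * norm (T y) \<le> p\<^sup>2 * (norm (T z))\<^sup>2 + q\<^sup>2 * (norm (T w))\<^sup>2"
      using sum_squares_bound[of "norm (T x)" "norm (T y)"] by (simp add: mult.assoc)
  qed
  finally have "- (T x \<bullet> T y) \<le> k * (p\<^sup>2 * (norm (T z))\<^sup>2 + q\<^sup>2 * (norm (T w))\<^sup>2)" .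
  moreover have "T x \<bullet> T y = p\<^sup>2 * (norm (T z))\<^sup>2 - q\<^sup>2 * (norm (T w))\<^sup>2"
    unfolding power2_norm_eq_inner
    by (simp add: x_def y_def linear_add[OF T] linear_diff[OF T] linear_scale[OF T]
        inner_add_left inner_diff_right power2_eq_square inner_commute[of "T w" "T z"]
        algebra_simps)
  ultimately have "(1 - k) * (q\<^sup>2 * (norm (T w))\<^sup>2) \<le> (1 + k) * (p\<^sup>2 * (norm (T z))\<^sup>2)"
    by (simp add: algebra_simps)
  then show ?thesis
    by (simp add: pq mult.assoc)
qed

text \<open>
  Since \<open>\<epsilon> - \<bar>c\<bar> < 1\<close>, the left-hand factor \<open>1 - k\<close> of the previous estimate can be taken
  positive; scaling each vector by the norm of the other gives them equal lengths.
\<close>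

lemma angle_preserving_orthogonal:
  fixes T :: "'a::real_inner \<Rightarrow> 'b::real_inner"
  assumes T: "linear T" and ap: "angle_preserving \<epsilon> c T" and c: "\<bar>c\<bar> < 1"
    and eps: "\<epsilon> < 1 + \<bar>c\<bar>"
  obtains \<mu> where "0 < \<mu>"
    and "\<And>z w. z \<bullet> w = 0 \<Longrightarrow> \<mu> * (norm (T w) * norm z) \<le> norm (T z) * norm w"
proof -
  define k where "k = max 0 (\<epsilon> - \<bar>c\<bar>)"
  have k: "0 \<le> k" "\<epsilon> - \<bar>c\<bar> \<le> k" "k < 1" using eps by (auto simp: k_def)
  define r where "r = ((1 - k) * (1 - \<bar>c\<bar>)) / ((1 + k) * (1 + \<bar>c\<bar>))"
  have den: "0 < (1 + k) * (1 + \<bar>c\<bar>)" using k by (intro mult_pos_pos) auto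
  have "0 < r" using k c den unfolding r_def by (intro divide_pos_pos mult_pos_pos) auto
  have "sqrt r * (norm (T w) * norm z) \<le> norm (T z) * norm w" if orth: "z \<bullet> w = 0" for z w
  proof -
    have "(1 - k) * (1 - \<bar>c\<bar>) * (norm (T (norm z *\<^sub>R w)))\<^sup>2
        \<le> (1 + k) * (1 + \<bar>c\<bar>) * (norm (T (norm w *\<^sub>R z)))\<^sup>2"
      using orth c k
      by (intro angle_preserving_orthogonal_sq[OF T angle_preserving_abs[OF T ap]])
        (auto simp: mult.commute)
    then have "r * (norm (T w) * norm z)\<^sup>2 \<le> (norm (T z) * norm w)\<^sup>2"
      unfolding r_def using den
      by (simp add: linear_scale[OF T] divide_le_eq mult.commute mult.left_commute)
    then have "(sqrt r * (norm (T w) * norm z))\<^sup>2 \<le> (norm (T z) * norm w)\<^sup>2"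
      using \<open>0 < r\<close> by (simp add: power_mult_distrib[of "sqrt r"])
    then show ?thesis by (rule power2_le_imp_le) simp
  qed
  with \<open>0 < r\<close> show ?thesis by (intro that[of "sqrt r"]) auto
qed

text \<open>
  Split a vector \<open>w\<close> with \<open>T w \<noteq> 0\<close> into its component along \<open>z\<close> and a component \<open>v\<close>
  orthogonal to \<open>z\<close>: the images of both are controlled by \<open>T z\<close>, so \<open>T z\<close> cannot be small
  compared with \<open>z\<close>.
\<close>

lemma bounded_below_if_orthogonal_comparable:
  fixes T :: "'a::real_inner \<Rightarrow> 'b::real_inner"
  assumes T: "linear T" and nz: "T w \<noteq> 0" and mu: "0 < \<mu>"
    and comp: "\<And>z v. z \<bullet> v = 0 \<Longrightarrow> \<mu> * (norm (T v) * norm z) \<le> norm (T z) * norm v"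
  shows "bounded_below T"
proof -
  define m where "m = \<mu> * norm (T w) / ((1 + \<mu>) * norm w)"
  have "w \<noteq> 0" using nz linear_0[OF T] by auto
  then have den: "0 < (1 + \<mu>) * norm w" using mu by simp
  have "0 < m" using mu nz den unfolding m_def by simp
  moreover have "m * norm z \<le> norm (T z)" for z
  proof (cases "z = 0")
    case True
    then show ?thesis by simp
  next
    case False
    define t where "t = (w \<bullet> z) / (z \<bullet> z)"
    define v where "v = w - t *\<^sub>R z"
    have orth: "z \<bullet> v = 0"
      using False by (simp add: v_def t_def inner_diff_right inner_commute)
    have w: "w = t *\<^sub>R z + v" by (simp add: v_def)
    \<comment> \<open>Pythagoras: both components are no longer than \<open>w\<close>.\<close>
    have pyth: "(norm w)\<^sup>2 = (norm (t *\<^sub>R z))\<^sup>2 + (norm v)\<^sup>2"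
      using orth by (subst w) (simp add: norm_add_Pythagorean orthogonal_def)
    have along: "\<bar>t\<bar> * norm z \<le> norm w"
      using pyth power2_le_imp_le[of "norm (t *\<^sub>R z)" "norm w"] by simp
    have across: "norm v \<le> norm w"
      using pyth power2_le_imp_le[of "norm v" "norm w"] by simp
    have "norm (T w) \<le> \<bar>t\<bar> * norm (T z) + norm (T v)"
      using norm_triangle_ineq[of "T (t *\<^sub>R z)" "T v"]
      by (subst w) (simp add: linear_add[OF T] linear_scale[OF T])
    then have "\<mu> * (norm (T w) * norm z) \<le> \<mu> * ((\<bar>t\<bar> * norm (T z) + norm (T v)) * norm z)"
      using mu by (intro mult_left_mono mult_right_mono) auto
    also have "\<dots> = \<mu> * norm (T z) * (\<bar>t\<bar> * norm z) + \<mu> * (norm (T v) * norm z)"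
      by (simp add: algebra_simps)
    also have "\<dots> \<le> \<mu> * norm (T z) * norm w + norm (T z) * norm w"
      using along across mu order_trans[OF comp[OF orth] mult_left_mono[OF across norm_ge_zero]]
      by (intro add_mono mult_left_mono) auto
    also have "\<dots> = norm (T z) * ((1 + \<mu>) * norm w)"
      by (simp add: algebra_simps)
    finally show ?thesis
      unfolding m_def using den by (simp add: divide_le_eq mult.assoc)
  qed
  ultimately show ?thesis by (auto simp: bounded_below_def)
qed

section \<open>The characterization\<close>

theorem corollary3p4:
  fixes T :: "'h::{real_inner, complete_space} \<Rightarrow> 'k::{real_inner, complete_space}"
    and c :: real
  assumes "dim_at_least 2 TYPE('h)" and "dim_at_least 2 TYPE('k)"
    and "bounded_linear T" and "T \<noteq> (\<lambda>x. 0)"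
    and "c \<in> {-1<..<1}"
  shows "(\<exists>\<epsilon>\<in>{0..<1 + \<bar>c\<bar>}. angle_preserving \<epsilon> c T) \<longleftrightarrow> bounded_below T"
proof -
  have T: "linear T" using assms(3) by (rule bounded_linear.linear)
  obtain w where w: "T w \<noteq> 0" using assms(4) by auto
  have c: "\<bar>c\<bar> < 1" using assms(5) by auto
  show ?thesis
  proof
    assume "\<exists>\<epsilon>\<in>{0..<1 + \<bar>c\<bar>}. angle_preserving \<epsilon> c T"
    then obtain \<epsilon> where "angle_preserving \<epsilon> c T" "\<epsilon> < 1 + \<bar>c\<bar>" by auto
    then show "bounded_below T"
      using angle_preserving_orthogonal[OF T _ c]
        bounded_below_if_orthogonal_comparable[OF T w] by metis
  next
    assume "bounded_below T"
    then show "\<exists>\<epsilon>\<in>{0..<1 + \<bar>c\<bar>}. angle_preserving \<epsilon> c T"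
      by (rule bounded_below_imp_angle_preserving[OF assms(3) w c])
  qed
qed

end
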